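(* There is a universal constant $C>0$ such that for every even integer $n>0$, if $B_{1/2}^n$ is a maximal class of pairwise non-isomorphic locally $1/2$-biased functions on $\{-1,1\}^n$, then $$|B_{1/2}^n| \geq C\,2^{\sqrt{n}}/n^{1/4}.$$
   Context: The hypercube $\{-1,1\}^n$ is regarded as a graph in which two vertices are adjacent iff they differ in exactly one coordinate. A function $f:\{-1,1\}^n\to\{-1,1\}$ is locally $p$-biased if for every vertex $x$, $|\{y\sim x : f(y)=1\}|/n = p$. Two functions $f,g:\{-1,1\}^n\to\{-1,1\}$ are isomorphic if there is a graph automorphism $\psi$ of the hypercube with $f\circ\psi=g$, and non-isomorphic otherwise. *)

theory Defs
  imports Complex_Main "HOL-Library.FuncSet"
begin

text \<open>
  Vertices and functions on the cube are extensional (\<open>undefined\<close> off their domain), so that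
  HOL equality is equality on the domain and \<open>card\<close> counts each vertex or function once.
\<close>

definition hypercube :: "nat \<Rightarrow> (nat \<Rightarrow> int) set" where
  "hypercube n = {..<n} \<rightarrow>\<^sub>E {-1, 1}"

definition adjacent :: "nat \<Rightarrow> (nat \<Rightarrow> int) \<Rightarrow> (nat \<Rightarrow> int) \<Rightarrow> bool" where
  "adjacent n x y \<longleftrightarrow> card {i \<in> {..<n}. x i \<noteq> y i} = 1"

definition cube_functions :: "nat \<Rightarrow> ((nat \<Rightarrow> int) \<Rightarrow> int) set" where
  "cube_functions n = hypercube n \<rightarrow>\<^sub>E {-1, 1}"

definition hypercube_automorphism :: "nat \<Rightarrow> ((nat \<Rightarrow> int) \<Rightarrow> (nat \<Rightarrow> int)) \<Rightarrow> bool" where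
  "hypercube_automorphism n \<psi> \<longleftrightarrow>
     bij_betw \<psi> (hypercube n) (hypercube n) \<and>
     (\<forall>x\<in>hypercube n. \<forall>y\<in>hypercube n. adjacent n (\<psi> x) (\<psi> y) \<longleftrightarrow> adjacent n x y)"

definition isomorphic :: "nat \<Rightarrow> ((nat \<Rightarrow> int) \<Rightarrow> int) \<Rightarrow> ((nat \<Rightarrow> int) \<Rightarrow> int) \<Rightarrow> bool" where
  "isomorphic n f g \<longleftrightarrow>
     (\<exists>\<psi>. hypercube_automorphism n \<psi> \<and> (\<forall>x\<in>hypercube n. (f \<circ> \<psi>) x = g x))"

definition locally_biased :: "nat \<Rightarrow> real \<Rightarrow> ((nat \<Rightarrow> int) \<Rightarrow> int) \<Rightarrow> bool" where
  "locally_biased n p f \<longleftrightarrow>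
     (\<forall>x\<in>hypercube n. real (card {y \<in> hypercube n. adjacent n x y \<and> f y = 1}) / real n = p)"

definition non_isomorphic_class :: "nat \<Rightarrow> real \<Rightarrow> ((nat \<Rightarrow> int) \<Rightarrow> int) set \<Rightarrow> bool" where
  "non_isomorphic_class n p B \<longleftrightarrow>
     B \<subseteq> {f \<in> cube_functions n. locally_biased n p f} \<and>
     pairwise (\<lambda>f g. \<not> isomorphic n f g) B"

text \<open>Maximal with respect to inclusion, i.e. a system of representatives of the isomorphism classes.\<close>

definition maximal_non_isomorphic_class :: "nat \<Rightarrow> real \<Rightarrow> ((nat \<Rightarrow> int) \<Rightarrow> int) set \<Rightarrow> bool" where
  "maximal_non_isomorphic_class n p B \<longleftrightarrow>
     non_isomorphic_class n p B \<and>
     (\<forall>B'. non_isomorphic_class n p B' \<and> B \<subseteq> B' \<longrightarrow> B' = B)"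

end

theory Submission
  imports Defs
begin

text \<open>
  Write \<open>n = 2 * m\<close>. The lower bound comes from comparing two counts: there are doubly exponentially
  many locally \<open>1/2\<close>-biased functions, but only \<open>2\<close> to a quadratic polynomial in \<open>n\<close> automorphisms.

  For the first count, group the coordinates into the pairs \<open>(x i, x (m + i))\<close>, \<open>i < m\<close>. For an
  arbitrary sign function \<open>l\<close> on the cube of dimension \<open>m\<close>, consider
  \<open>f x = l (\<lambda>i. x i * x (m + i)) * (\<Prod>i<m. x i)\<close>. Negating \<open>x i\<close> and negating \<open>x (m + i)\<close> change the
  argument of \<open>l\<close> in the same way, but only the former changes the sign of the product. So \<open>f\<close> takes
  opposite values at these two neighbours of \<open>x\<close>, and exactly half of the neighbours of \<open>x\<close> have
  value \<open>1\<close>. As \<open>l\<close> is recovered from \<open>f\<close>, this gives \<open>2 ^ 2 ^ m\<close> functions (\<open>card_balanced_ge\<close>).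

  For the second count, two vertices have at most two common neighbours. Hence an automorphism is
  determined, level by level, by its values at one vertex and at the neighbours of that vertex,
  which leaves at most \<open>(2 ^ n) ^ (n + 1)\<close> of them (\<open>card_cube_automorphisms_le\<close>).

  Each locally \<open>1/2\<close>-biased function is \<open>g \<circ> \<psi>\<close> for a member \<open>g\<close> of the maximal class and an
  automorphism \<open>\<psi>\<close> (\<open>card_locally_biased_le\<close>), so the class has at least
  \<open>2 ^ (2 ^ m - n * (n + 1))\<close> members. For \<open>m \<ge> 9\<close> this is at least \<open>2 ^ n\<close>, well above
  \<open>2 powr sqrt n\<close>; for smaller \<open>m\<close> it is enough that the class is nonempty, if \<open>C\<close> is small.
\<close>

section \<open>Neighbours in the cube\<close>

definition flip :: "nat \<Rightarrow> (nat \<Rightarrow> int) \<Rightarrow> nat \<Rightarrow> int" where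
  "flip a x = x(a := - x a)"

lemma hypercube_values: "x \<in> hypercube n \<Longrightarrow> i < n \<Longrightarrow> x i = 1 \<or> x i = -1"
  by (auto simp: hypercube_def)

lemma finite_hypercube: "finite (hypercube n)"
  unfolding hypercube_def by (intro finite_PiE) auto

lemma card_hypercube: "card (hypercube n) = 2 ^ n"
  unfolding hypercube_def by (simp add: card_PiE numeral_2_eq_2)

lemma finite_cube_functions: "finite (cube_functions n)"
  unfolding cube_functions_def by (intro finite_PiE) (auto simp: finite_hypercube)

lemma card_cube_functions: "card (cube_functions n) = 2 ^ 2 ^ n"
  unfolding cube_functions_def
  by (simp add: card_PiE finite_hypercube card_hypercube numeral_2_eq_2)

lemma flip_flip [simp]: "flip a (flip a x) = x"
  by (auto simp: flip_def)

lemma flip_in_hypercube: "x \<in> hypercube n \<Longrightarrow> a < n \<Longrightarrow> flip a x \<in> hypercube n"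
  by (auto simp: hypercube_def flip_def PiE_iff extensional_def)

lemma adjacent_iff_flip:
  assumes x: "x \<in> hypercube n" and y: "y \<in> hypercube n"
  shows "adjacent n x y \<longleftrightarrow> (\<exists>a<n. y = flip a x)"
proof
  assume "adjacent n x y"
  then obtain a where a: "{i \<in> {..<n}. x i \<noteq> y i} = {a}"
    by (auto simp: adjacent_def card_1_singleton_iff)
  then have an: "a < n" and ne: "x a \<noteq> y a" by auto
  have "y i = flip a x i" for i
  proof (cases "i < n")
    case True
    show ?thesis
    proof (cases "i = a")
      case True
      with ne an hypercube_values[OF x an] hypercube_values[OF y an]
      show ?thesis by (auto simp: flip_def)
    next
      case False
      with \<open>i < n\<close> a have "x i = y i" by auto
      with False show ?thesis by (simp add: flip_def)
    qed
  next
    case False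
    then show ?thesis using x y an
      by (auto simp: flip_def hypercube_def PiE_iff extensional_def)
  qed
  with an show "\<exists>a<n. y = flip a x" by blast
next
  assume "\<exists>a<n. y = flip a x"
  then obtain a where a: "a < n" "y = flip a x" by blast
  with hypercube_values[OF x a(1)] have "{i \<in> {..<n}. x i \<noteq> y i} = {a}"
    by (auto simp: flip_def)
  then show "adjacent n x y" by (simp add: adjacent_def)
qed

lemma inj_on_flip:
  assumes x: "x \<in> hypercube n"
  shows "inj_on (\<lambda>a. flip a x) {..<n}"
proof (rule inj_onI)
  fix a b assume "a \<in> {..<n}" "b \<in> {..<n}" "flip a x = flip b x"
  then have "flip a x a = flip b x a" "a < n" by auto
  with hypercube_values[OF x \<open>a < n\<close>] show "a = b"
    by (auto simp: flip_def split: if_splits)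
qed

lemma neighbours_eq:
  assumes "x \<in> hypercube n"
  shows "{y \<in> hypercube n. adjacent n x y \<and> P y} = (\<lambda>a. flip a x) ` {a \<in> {..<n}. P (flip a x)}"
  using adjacent_iff_flip[OF assms] flip_in_hypercube[OF assms] by auto

section \<open>Many balanced functions\<close>

text \<open>
  In Fourier terms, these are the sign functions in the tensor product, over the pairs
  \<open>{i, m + i}\<close>, of the kernels of the adjacency operators of the \<open>4\<close>-cycles. Such a kernel is spanned
  by \<open>(x i + x (m + i)) / 2\<close> and \<open>(x i - x (m + i)) / 2\<close>, whose supports are disjoint; hence
  the coefficients \<open>l\<close> in the product basis can be chosen freely.
\<close>

definition twisted_parity :: "nat \<Rightarrow> ((nat \<Rightarrow> int) \<Rightarrow> int) \<Rightarrow> (nat \<Rightarrow> int) \<Rightarrow> int" where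
  "twisted_parity m l = (\<lambda>x\<in>hypercube (2 * m). l (\<lambda>i\<in>{..<m}. x i * x (m + i)) * (\<Prod>i<m. x i))"

lemma pair_products_in_hypercube:
  assumes "x \<in> hypercube (2 * m)"
  shows "(\<lambda>i\<in>{..<m}. x i * x (m + i)) \<in> hypercube m"
proof -
  have "x i * x (m + i) \<in> {-1, 1}" if "i < m" for i
    using hypercube_values[OF assms, of i] hypercube_values[OF assms, of "m + i"] that by auto
  then show ?thesis by (auto simp: hypercube_def)
qed

lemma prod_signs: "(\<And>i. i \<in> A \<Longrightarrow> x i = 1 \<or> x i = (-1::int)) \<Longrightarrow> prod x A = 1 \<or> prod x A = -1"
  by (induction A rule: infinite_finite_induct) (auto, force+)

lemma twisted_parity_in_cube_functions:
  assumes "l \<in> cube_functions m"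
  shows "twisted_parity m l \<in> cube_functions (2 * m)"
proof -
  have "l (\<lambda>i\<in>{..<m}. x i * x (m + i)) * (\<Prod>i<m. x i) \<in> {-1, 1}" if x: "x \<in> hypercube (2 * m)" for x
  proof -
    have "l (\<lambda>i\<in>{..<m}. x i * x (m + i)) \<in> {-1, 1}"
      using assms pair_products_in_hypercube[OF x] by (auto simp: cube_functions_def)
    moreover have "(\<Prod>i<m. x i) = 1 \<or> (\<Prod>i<m. x i) = -1"
      by (rule prod_signs) (use hypercube_values[OF x] in auto)
    ultimately show ?thesis by auto
  qed
  then show ?thesis unfolding cube_functions_def twisted_parity_def by auto
qed

text \<open>
  Both flips negate the \<open>i\<close>-th pair product and fix the others, so \<open>l\<close> is evaluated at the
  same point; the parity factor involves \<open>x i\<close> but not \<open>x (m + i)\<close>.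
\<close>

lemma twisted_parity_flip_opposite:
  assumes x: "x \<in> hypercube (2 * m)" and i: "i < m"
  shows "twisted_parity m l (flip (m + i) x) = - twisted_parity m l (flip i x)"
proof -
  have v: "(\<lambda>j\<in>{..<m}. flip (m + i) x j * flip (m + i) x (m + j))
      = (\<lambda>j\<in>{..<m}. flip i x j * flip i x (m + j))"
    using i by (auto simp: flip_def fun_eq_iff)
  have "(\<Prod>j<m. flip (m + i) x j) = (\<Prod>j<m. x j)"
    by (rule prod.cong) (auto simp: flip_def)
  moreover have "(\<Prod>j<m. flip i x j) = - (\<Prod>j<m. x j)"
  proof -
    have "(\<Prod>j<m. flip i x j) = flip i x i * (\<Prod>j\<in>{..<m} - {i}. flip i x j)"
      using i by (intro prod.remove) auto
    also have "(\<Prod>j\<in>{..<m} - {i}. flip i x j) = (\<Prod>j\<in>{..<m} - {i}. x j)"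
      by (rule prod.cong) (auto simp: flip_def)
    also have "flip i x i * \<dots> = - (x i * (\<Prod>j\<in>{..<m} - {i}. x j))"
      by (simp add: flip_def)
    also have "x i * (\<Prod>j\<in>{..<m} - {i}. x j) = (\<Prod>j<m. x j)"
      using i by (intro prod.remove[symmetric]) auto
    finally show ?thesis .
  qed
  ultimately show ?thesis
    using v flip_in_hypercube[OF x, of i] flip_in_hypercube[OF x, of "m + i"] i
    by (simp add: twisted_parity_def)
qed

lemma locally_biased_twisted_parity:
  assumes l: "l \<in> cube_functions m" and m: "m > 0"
  shows "locally_biased (2 * m) (1 / 2) (twisted_parity m l)"
  unfolding locally_biased_def
proof
  fix x assume x: "x \<in> hypercube (2 * m)"
  define P where "P a \<longleftrightarrow> twisted_parity m l (flip a x) = 1" for a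
  have opp: "P (m + i) \<longleftrightarrow> \<not> P i" if i: "i < m" for i
  proof -
    have "flip i x \<in> hypercube (2 * m)" using i by (intro flip_in_hypercube[OF x]) auto
    then have "twisted_parity m l (flip i x) \<in> {-1, 1}"
      using twisted_parity_in_cube_functions[OF l] by (auto simp: cube_functions_def)
    then show ?thesis using twisted_parity_flip_opposite[OF x i, of l] by (auto simp: P_def)
  qed
  have "{a \<in> {..<2 * m}. P a} = {i \<in> {..<m}. P i} \<union> (+) m ` {i \<in> {..<m}. \<not> P i}" (is "?L = ?R")
  proof (intro set_eqI iffI)
    fix a assume "a \<in> ?L"
    then have a: "a < 2 * m" "P a" by auto
    show "a \<in> ?R"
    proof (cases "a < m")
      case False
      then have "a - m \<in> {i \<in> {..<m}. \<not> P i}" "a = m + (a - m)" using a opp[of "a - m"] by auto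
      then show ?thesis by blast
    qed (use a in auto)
  next
    fix a assume "a \<in> ?R"
    then show "a \<in> ?L" using opp by auto
  qed
  then have "card {a \<in> {..<2 * m}. P a} = card {i \<in> {..<m}. P i} + card ((+) m ` {i \<in> {..<m}. \<not> P i})"
    by (simp only:) (rule card_Un_disjoint, auto)
  also have "card ((+) m ` {i \<in> {..<m}. \<not> P i}) = card {i \<in> {..<m}. \<not> P i}"
    by (rule card_image) auto
  also have "card {i \<in> {..<m}. P i} + card {i \<in> {..<m}. \<not> P i} = card ({i \<in> {..<m}. P i} \<union> {i \<in> {..<m}. \<not> P i})"
    by (rule card_Un_disjoint[symmetric]) auto
  also have "{i \<in> {..<m}. P i} \<union> {i \<in> {..<m}. \<not> P i} = {..<m}" by auto
  finally have "card {a \<in> {..<2 * m}. P a} = m" by simp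
  moreover have "card {y \<in> hypercube (2 * m). adjacent (2 * m) x y \<and> twisted_parity m l y = 1}
      = card {a \<in> {..<2 * m}. P a}"
    unfolding neighbours_eq[OF x, of "\<lambda>y. twisted_parity m l y = 1"] P_def
    by (intro card_image inj_on_subset[OF inj_on_flip[OF x]]) auto
  ultimately show "real (card {y \<in> hypercube (2 * m). adjacent (2 * m) x y \<and> twisted_parity m l y = 1})
      / real (2 * m) = 1 / 2"
    using m by simp
qed

text \<open>
  Each point \<open>v\<close> of the small cube is the vector of pair products of a point of the large cube whose
  parity factor is \<open>1\<close>, and there the twisted parity of \<open>l\<close> is \<open>l v\<close>.
\<close>

lemma inj_on_twisted_parity: "inj_on (twisted_parity m) (cube_functions m)"
proof (rule inj_onI)
  fix k l assume kl: "k \<in> cube_functions m" "l \<in> cube_functions m"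
    and eq: "twisted_parity m k = twisted_parity m l"
  show "k = l"
  proof (rule PiE_ext)
    show "k \<in> hypercube m \<rightarrow>\<^sub>E {-1, 1}" "l \<in> hypercube m \<rightarrow>\<^sub>E {-1, 1}"
      using kl by (auto simp: cube_functions_def)
  next
    fix v assume v: "v \<in> hypercube m"
    define x where "x = (\<lambda>i\<in>{..<2 * m}. if i < m then 1 else v (i - m))"
    have "v (i - m) \<in> {-1, 1}" if "i < 2 * m" "\<not> i < m" for i
      using hypercube_values[OF v, of "i - m"] that by auto
    then have x: "x \<in> hypercube (2 * m)"
      by (auto simp: hypercube_def x_def)
    have "(\<lambda>i\<in>{..<m}. x i * x (m + i)) = v"
      using v by (auto simp: x_def fun_eq_iff hypercube_def PiE_iff extensional_def)
    moreover have "(\<Prod>i<m. x i) = 1"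
      by (rule prod.neutral) (auto simp: x_def)
    ultimately have "twisted_parity m j x = j v" for j
      using x by (simp add: twisted_parity_def)
    then show "k v = l v" using eq by metis
  qed
qed

lemma card_balanced_ge:
  assumes "m > 0"
  shows "2 ^ 2 ^ m \<le> card {f \<in> cube_functions (2 * m). locally_biased (2 * m) (1 / 2) f}"
proof -
  have "card (cube_functions m) \<le> card {f \<in> cube_functions (2 * m). locally_biased (2 * m) (1 / 2) f}"
    using inj_on_twisted_parity
  proof (rule card_inj_on_le)
    show "twisted_parity m ` cube_functions m
        \<subseteq> {f \<in> cube_functions (2 * m). locally_biased (2 * m) (1 / 2) f}"
      using twisted_parity_in_cube_functions locally_biased_twisted_parity assms by auto
  qed (simp add: finite_cube_functions)
  then show ?thesis by (simp add: card_cube_functions)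
qed

section \<open>Few automorphisms\<close>

text \<open>
  A common neighbour of two distinct vertices flips one of the two coordinates in which they differ.
\<close>

lemma at_most_two_common_neighbours:
  assumes u: "u \<in> hypercube n" and v: "v \<in> hypercube n" and "u \<noteq> v"
    and p: "p \<in> hypercube n" "adjacent n u p" "adjacent n v p"
    and q: "q \<in> hypercube n" "adjacent n u q" "adjacent n v q"
    and w: "w \<in> hypercube n" "adjacent n u w" "adjacent n v w"
    and "p \<noteq> w" "q \<noteq> w"
  shows "p = q"
proof -
  have *: "\<exists>a b. a < n \<and> b < n \<and> r = flip a u \<and> v = flip b (flip a u) \<and> a \<noteq> b"
    if r: "r \<in> hypercube n" "adjacent n u r" "adjacent n v r" for r
  proof -
    from r u v obtain a b where ab: "a < n" "b < n" "r = flip a u" "r = flip b v"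
      using adjacent_iff_flip by metis
    then have "v = flip b (flip a u)" by (metis flip_flip)
    moreover from this \<open>u \<noteq> v\<close> have "a \<noteq> b" by auto
    ultimately show ?thesis using ab by blast
  qed
  have differ: "{i. u i \<noteq> v i} = {a, b}" if "a < n" "b < n" "v = flip b (flip a u)" "a \<noteq> b" for a b
    using that hypercube_values[OF u, of a] hypercube_values[OF u, of b]
    by (auto simp: flip_def)
  obtain a b where p': "a < n" "b < n" "p = flip a u" "v = flip b (flip a u)" "a \<noteq> b"
    using *[OF p] by blast
  obtain c d where q': "c < n" "d < n" "q = flip c u" "v = flip d (flip c u)" "c \<noteq> d"
    using *[OF q] by blast
  obtain e f where w': "e < n" "f < n" "w = flip e u" "v = flip f (flip e u)" "e \<noteq> f"
    using *[OF w] by blast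
  have "{a, b} = {e, f}" "{c, d} = {e, f}"
    using differ p' q' w' by metis+
  moreover have "a \<noteq> e" "c \<noteq> e" using \<open>p \<noteq> w\<close> \<open>q \<noteq> w\<close> p' q' w' by auto
  ultimately have "a = c" by auto
  then show ?thesis using p' q' by simp
qed

definition all_ones :: "nat \<Rightarrow> nat \<Rightarrow> int" where
  "all_ones n = (\<lambda>i\<in>{..<n}. 1)"

definition unit_ball :: "nat \<Rightarrow> (nat \<Rightarrow> int) set" where
  "unit_ball n = insert (all_ones n) ((\<lambda>a. flip a (all_ones n)) ` {..<n})"

lemma all_ones_in_hypercube: "all_ones n \<in> hypercube n"
  by (auto simp: all_ones_def hypercube_def)

lemma unit_ball_subset: "unit_ball n \<subseteq> hypercube n"
  by (auto simp: unit_ball_def all_ones_in_hypercube flip_in_hypercube)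

lemma card_unit_ball: "card (unit_ball n) \<le> n + 1"
  unfolding unit_ball_def
  using card_insert_le_m1[of "n + 1"] card_image_le[of "{..<n}" "\<lambda>a. flip a (all_ones n)"]
  by (auto simp: card_insert_if)

lemma finite_unit_ball: "finite (unit_ball n)"
  by (simp add: unit_ball_def)

text \<open>
  Induction on the number of coordinates \<open>-1\<close>. If \<open>x\<close> has two of them, \<open>i\<close> and \<open>j\<close>, resetting \<open>i\<close>,
  \<open>j\<close>, or both gives vertices \<open>y\<close>, \<open>z\<close>, \<open>w\<close> that are covered by the induction hypothesis, and the common
  neighbours of \<open>y\<close> and \<open>z\<close> are \<open>w\<close> and \<open>x\<close>. The image of \<open>x\<close> is therefore forced to be the
  common neighbour of the images of \<open>y\<close> and \<open>z\<close> that is not the image of \<open>w\<close>.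
\<close>

lemma automorphism_determined_by_unit_ball:
  assumes phi: "hypercube_automorphism n \<phi>" and psi: "hypercube_automorphism n \<psi>"
    and eq: "\<And>y. y \<in> unit_ball n \<Longrightarrow> \<phi> y = \<psi> y"
    and x: "x \<in> hypercube n"
  shows "\<phi> x = \<psi> x"
  using x
proof (induction "card {i \<in> {..<n}. x i = -1}" arbitrary: x rule: less_induct)
  case less
  note x = \<open>x \<in> hypercube n\<close>
  define N where "N y = {i \<in> {..<n}. y i = (-1::int)}" for y
  have fin: "finite (N y)" for y by (simp add: N_def)
  show ?case
  proof (cases "\<exists>i j. i \<in> N x \<and> j \<in> N x \<and> i \<noteq> j")
    case False
    have "x \<in> unit_ball n"
    proof (cases "N x = {}")
      case True
      then have "x = all_ones n"
        using hypercube_values[OF x] x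
        by (auto simp: N_def all_ones_def fun_eq_iff hypercube_def PiE_iff extensional_def)
      then show ?thesis by (simp add: unit_ball_def)
    next
      case nonempty: False
      then obtain i where "N x = {i}" using False by blast
      then have i: "i < n" "x i = -1" "\<And>j. j < n \<Longrightarrow> j \<noteq> i \<Longrightarrow> x j \<noteq> -1"
        by (auto simp: N_def)
      have "x = flip i (all_ones n)"
      proof
        fix j
        show "x j = flip i (all_ones n) j"
          using i hypercube_values[OF x, of j] x
          by (auto simp: flip_def all_ones_def hypercube_def PiE_iff extensional_def)
      qed
      then show ?thesis using i by (auto simp: unit_ball_def)
    qed
    then show ?thesis by (rule eq)
  next
    case True
    then obtain i j where ij: "i \<in> N x" "j \<in> N x" "i \<noteq> j" by blast
    then have ijn: "i < n" "j < n" and xij: "x i = -1" "x j = -1" by (auto simp: N_def)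
    define y where "y = flip i x"
    define z where "z = flip j x"
    define w where "w = flip j y"
    have cube: "y \<in> hypercube n" "z \<in> hypercube n" "w \<in> hypercube n"
      using x ijn by (auto simp: y_def z_def w_def flip_in_hypercube)
    have w': "w = flip i z" using ij by (auto simp: w_def y_def z_def flip_def)
    have "N y = N x - {i}" "N z = N x - {j}" "N w = N x - {i, j}"
      using ij xij by (auto simp: N_def y_def z_def w_def flip_def)
    then have "N y \<subset> N x" "N z \<subset> N x" "N w \<subset> N x" using ij by auto
    then have less_card: "card (N y) < card (N x)" "card (N z) < card (N x)" "card (N w) < card (N x)"
      by (auto intro: psubset_card_mono fin)
    have agree: "\<phi> y = \<psi> y" "\<phi> z = \<psi> z" "\<phi> w = \<psi> w"
      using less.hyps cube less_card unfolding N_def by blast+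
    have yz: "y \<noteq> z" using ij xij by (auto simp: y_def z_def flip_def fun_eq_iff dest: spec[of _ i])
    have xw: "x \<noteq> w" using ij xij by (auto simp: y_def w_def flip_def fun_eq_iff dest: spec[of _ i])
    have adj: "adjacent n y x" "adjacent n z x" "adjacent n y w" "adjacent n z w"
      using adjacent_iff_flip x cube ijn w' w_def y_def z_def by (metis flip_flip)+
    have im: "\<theta> v \<in> hypercube n" if "hypercube_automorphism n \<theta>" "v \<in> hypercube n" for \<theta> v
      using that by (auto simp: hypercube_automorphism_def bij_betw_def)
    have inj: "\<theta> u \<noteq> \<theta> v"
      if "hypercube_automorphism n \<theta>" "u \<in> hypercube n" "v \<in> hypercube n" "u \<noteq> v" for \<theta> u v
      using that by (auto simp: hypercube_automorphism_def bij_betw_def inj_on_def)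
    have pres: "adjacent n (\<theta> u) (\<theta> v)"
      if "hypercube_automorphism n \<theta>" "u \<in> hypercube n" "v \<in> hypercube n" "adjacent n u v" for \<theta> u v
      using that by (auto simp: hypercube_automorphism_def)
    show ?thesis
    proof (rule at_most_two_common_neighbours)
      show "\<phi> y \<in> hypercube n" "\<phi> z \<in> hypercube n" "\<phi> x \<in> hypercube n" "\<psi> x \<in> hypercube n"
        "\<phi> w \<in> hypercube n"
        using im phi psi x cube by auto
      show "\<phi> y \<noteq> \<phi> z" "\<phi> x \<noteq> \<phi> w" using inj phi x cube yz xw by auto
      show "\<psi> x \<noteq> \<phi> w" using inj psi x cube xw agree by auto
      show "adjacent n (\<phi> y) (\<phi> x)" "adjacent n (\<phi> z) (\<phi> x)" "adjacent n (\<phi> y) (\<phi> w)"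
        "adjacent n (\<phi> z) (\<phi> w)"
        using pres phi x cube adj by auto
      show "adjacent n (\<phi> y) (\<psi> x)" "adjacent n (\<phi> z) (\<psi> x)"
        using pres[OF psi] x cube adj agree by auto
    qed
  qed
qed

text \<open>
  Automorphisms are unconstrained off the cube; taking them extensional makes the set finite and
  counts each one once.
\<close>

definition cube_automorphisms :: "nat \<Rightarrow> ((nat \<Rightarrow> int) \<Rightarrow> (nat \<Rightarrow> int)) set" where
  "cube_automorphisms n = {\<psi> \<in> hypercube n \<rightarrow>\<^sub>E hypercube n. hypercube_automorphism n \<psi>}"

lemma finite_cube_automorphisms: "finite (cube_automorphisms n)"
  unfolding cube_automorphisms_def
  by (rule finite_subset[of _ "hypercube n \<rightarrow>\<^sub>E hypercube n"])
    (auto intro: finite_PiE simp: finite_hypercube)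

lemma card_cube_automorphisms_le: "card (cube_automorphisms n) \<le> 2 ^ (n * (n + 1))"
proof -
  have "card (cube_automorphisms n) \<le> card (unit_ball n \<rightarrow>\<^sub>E hypercube n)"
  proof (rule card_inj_on_le)
    show "inj_on (\<lambda>\<psi>. restrict \<psi> (unit_ball n)) (cube_automorphisms n)"
    proof (rule inj_onI)
      fix \<phi> \<psi> assume *: "\<phi> \<in> cube_automorphisms n" "\<psi> \<in> cube_automorphisms n"
        "restrict \<phi> (unit_ball n) = restrict \<psi> (unit_ball n)"
      then have "\<phi> y = \<psi> y" if "y \<in> unit_ball n" for y
        using that by (metis restrict_apply')
      then have "\<phi> x = \<psi> x" if "x \<in> hypercube n" for x
        using automorphism_determined_by_unit_ball[of n \<phi> \<psi> x] * that
        unfolding cube_automorphisms_def by blast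
      moreover have "\<phi> \<in> hypercube n \<rightarrow>\<^sub>E hypercube n" "\<psi> \<in> hypercube n \<rightarrow>\<^sub>E hypercube n"
        using * unfolding cube_automorphisms_def by blast+
      ultimately show "\<phi> = \<psi>" by (meson PiE_ext)
    qed
    show "(\<lambda>\<psi>. restrict \<psi> (unit_ball n)) ` cube_automorphisms n \<subseteq> unit_ball n \<rightarrow>\<^sub>E hypercube n"
      using unit_ball_subset by (fastforce simp: cube_automorphisms_def)
    show "finite (unit_ball n \<rightarrow>\<^sub>E hypercube n)"
      by (intro finite_PiE finite_unit_ball finite_hypercube)
  qed
  also have "\<dots> = (2 ^ n) ^ card (unit_ball n)"
    by (simp add: card_PiE finite_unit_ball card_hypercube)
  also have "\<dots> \<le> (2 ^ n) ^ (n + 1)"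
    by (intro power_increasing card_unit_ball) auto
  finally show ?thesis by (simp only: power_mult)
qed

section \<open>Counting isomorphism classes\<close>

lemma isomorphic_refl: "isomorphic n f f"
  unfolding isomorphic_def hypercube_automorphism_def by (rule exI[of _ id]) auto

lemma isomorphic_sym:
  assumes "isomorphic n f g"
  shows "isomorphic n g f"
proof -
  obtain \<psi> where bij: "bij_betw \<psi> (hypercube n) (hypercube n)"
    and adj: "\<forall>x\<in>hypercube n. \<forall>y\<in>hypercube n. adjacent n (\<psi> x) (\<psi> y) \<longleftrightarrow> adjacent n x y"
    and fg: "\<forall>x\<in>hypercube n. (f \<circ> \<psi>) x = g x"
    using assms by (auto simp: isomorphic_def hypercube_automorphism_def)
  define \<phi> where "\<phi> = inv_into (hypercube n) \<psi>"
  have bij': "bij_betw \<phi> (hypercube n) (hypercube n)"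
    unfolding \<phi>_def using bij by (rule bij_betw_inv_into)
  have im: "\<phi> x \<in> hypercube n" "\<psi> (\<phi> x) = x" if "x \<in> hypercube n" for x
    using that bij bij' by (auto simp: \<phi>_def bij_betw_def f_inv_into_f)
  have "hypercube_automorphism n \<phi>"
    unfolding hypercube_automorphism_def using bij' adj im by metis
  moreover have "\<forall>x\<in>hypercube n. (g \<circ> \<phi>) x = f x"
    using fg im by (metis comp_apply)
  ultimately show ?thesis by (auto simp: isomorphic_def)
qed

text \<open>
  A function isomorphic to no member could be added to the class, contradicting maximality.
\<close>

lemma maximal_class_represents:
  assumes B: "maximal_non_isomorphic_class n p B"
    and f: "f \<in> cube_functions n" "locally_biased n p f"
  shows "\<exists>g\<in>B. isomorphic n g f"
proof (rule ccontr)
  assume no: "\<not> (\<exists>g\<in>B. isomorphic n g f)"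
  then have "f \<notin> B" using isomorphic_refl by blast
  have "non_isomorphic_class n p (insert f B)"
    using B f no isomorphic_sym
    unfolding maximal_non_isomorphic_class_def non_isomorphic_class_def pairwise_insert by blast
  then have "insert f B = B" using B unfolding maximal_non_isomorphic_class_def by blast
  with \<open>f \<notin> B\<close> show False by blast
qed

lemma card_locally_biased_le:
  assumes B: "maximal_non_isomorphic_class n p B"
  shows "card {f \<in> cube_functions n. locally_biased n p f} \<le> card B * card (cube_automorphisms n)"
proof -
  let ?T = "\<lambda>(g, \<psi>). restrict (g \<circ> \<psi>) (hypercube n)"
  have "B \<subseteq> cube_functions n"
    using B by (auto simp: maximal_non_isomorphic_class_def non_isomorphic_class_def)
  then have finB: "finite B" using finite_cube_functions finite_subset by blast
  have "{f \<in> cube_functions n. locally_biased n p f} \<subseteq> ?T ` (B \<times> cube_automorphisms n)"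
  proof
    fix f assume f: "f \<in> {f \<in> cube_functions n. locally_biased n p f}"
    then obtain g where g: "g \<in> B" "isomorphic n g f"
      using maximal_class_represents[OF B] by blast
    from g(2) obtain \<psi> where psi: "hypercube_automorphism n \<psi>"
      and eq: "\<forall>x\<in>hypercube n. (g \<circ> \<psi>) x = f x"
      unfolding isomorphic_def by (elim exE conjE)
    have im: "\<psi> x \<in> hypercube n" if "x \<in> hypercube n" for x
      using psi that by (auto simp: hypercube_automorphism_def bij_betw_def)
    have "bij_betw (restrict \<psi> (hypercube n)) (hypercube n) (hypercube n) \<longleftrightarrow>
        bij_betw \<psi> (hypercube n) (hypercube n)"
      by (rule bij_betw_cong) auto
    then have "restrict \<psi> (hypercube n) \<in> cube_automorphisms n"
      using psi im by (auto simp: cube_automorphisms_def hypercube_automorphism_def)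
    moreover have "f = ?T (g, restrict \<psi> (hypercube n))"
      using f eq by (auto simp: fun_eq_iff cube_functions_def PiE_iff extensional_def)
    ultimately show "f \<in> ?T ` (B \<times> cube_automorphisms n)" using g(1) by blast
  qed
  then have "card {f \<in> cube_functions n. locally_biased n p f} \<le> card (B \<times> cube_automorphisms n)"
    by (rule surj_card_le[rotated]) (simp add: finB finite_cube_automorphisms)
  then show ?thesis by (simp add: card_cartesian_product)
qed

text \<open>
  With \<open>n = 2 * m\<close> the left side is \<open>n * (n + 1) + n\<close>: the exponent of the bound on the automorphisms,
  and another \<open>n\<close> for the members of the class. The inequality fails for \<open>m = 8\<close>.
\<close>

lemma doubly_exponential_dominates:
  assumes "m \<ge> 9"
  shows "2 * m * (2 * m + 1) + 2 * m \<le> (2::nat) ^ m"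
  using assms
proof (induction m rule: dec_induct)
  case (step k)
  have "9 * k \<le> k * k" using step.hyps by (intro mult_right_mono) auto
  then have "8 + k * 4 \<le> k * (k * 4)" using step.hyps(1) by linarith
  then have "2 * Suc k * (2 * Suc k + 1) + 2 * Suc k \<le> 2 * (2 * k * (2 * k + 1) + 2 * k)"
    using step.hyps by (simp add: algebra_simps)
  also have "\<dots> \<le> 2 * 2 ^ k" using step.IH by (rule mult_left_mono) simp
  finally show ?case by simp
qed simp

theorem proposition3p5:
  shows "\<exists>C::real. C > 0 \<and>
    (\<forall>n::nat. even n \<and> n > 0 \<longrightarrow>
      (\<forall>B. maximal_non_isomorphic_class n (1 / 2) B \<longrightarrow>
        real (card B) \<ge> C * 2 powr sqrt (real n) / real n powr (1 / 4)))"
  \<comment> \<open>The constant is dictated by \<open>m \<le> 8\<close>: then \<open>sqrt n \<le> 4\<close> and \<open>2 powr sqrt n \<le> 16\<close>.\<close>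
proof (intro exI[of _ "1 / 16"] conjI allI impI)
  fix n :: nat and B
  assume n: "even n \<and> n > 0" and B: "maximal_non_isomorphic_class n (1 / 2) B"
  then obtain m where m: "n = 2 * m" "m > 0" by auto
  have count: "2 ^ 2 ^ m \<le> card B * 2 ^ (n * (n + 1))"
    using card_balanced_ge[OF m(2)] card_locally_biased_le[OF B]
      mult_left_mono[OF card_cube_automorphisms_le[of n], of "card B"]
    unfolding m(1) by linarith
  have "2 powr sqrt (real n) \<le> 16 * real (card B)"
  proof (cases "m \<ge> 9")
    case True
    have "2 ^ n * 2 ^ (n * (n + 1)) = (2::nat) ^ (n * (n + 1) + n)"
      by (simp add: power_add mult.commute)
    also have "\<dots> \<le> 2 ^ 2 ^ m"
      using doubly_exponential_dominates[OF True] m(1) by (intro power_increasing) auto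
    also note count
    finally have "2 ^ n \<le> card B" by simp
    then have "2 ^ n \<le> real (card B)"
      by (metis of_nat_le_iff of_nat_numeral of_nat_power)
    moreover have "sqrt (real n) \<le> real n"
      using n by (intro real_le_lsqrt) (auto simp: power2_eq_square)
    then have "2 powr sqrt (real n) \<le> 2 powr real n" by (intro powr_mono) auto
    then have "2 powr sqrt (real n) \<le> 2 ^ n" by (simp add: powr_realpow)
    ultimately show ?thesis by linarith
  next
    case False
    then have "sqrt (real n) \<le> 4" using m by (intro real_le_lsqrt) auto
    then have "2 powr sqrt (real n) \<le> 2 powr 4" by (intro powr_mono) auto
    moreover have "card B \<ge> 1" using count by (cases "card B") auto
    ultimately show ?thesis by simp
  qed
  moreover have ge1: "real n powr (1 / 4) \<ge> 1" using n by (intro ge_one_powr_ge_zero) auto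
  then have "real (card B) * 1 \<le> real (card B) * real n powr (1 / 4)"
    by (intro mult_left_mono) auto
  ultimately have "1 / 16 * 2 powr sqrt (real n) \<le> real (card B) * real n powr (1 / 4)"
    by linarith
  then show "1 / 16 * 2 powr sqrt (real n) / real n powr (1 / 4) \<le> real (card B)"
    using ge1 n by (subst pos_divide_le_eq) auto
qed simp

end
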